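(* Let $n\ge 1$ and let $A$ be a nonempty subset of $\mathbb{R}^n_+$. The following conditions are equivalent for every function $\Phi:A\to\mathbb{R}_+$. (i) The function $\Phi$ is isotone and subadditive. (ii) There is an isotone and subadditive function $\Psi:\mathbb{R}^n_+\to\mathbb{R}_+$ such that $\Psi|_{A}=\Phi$.
   Context: $\mathbb{R}_+=[0,\infty)$. For $\bar{x},\bar{y}\in\mathbb{R}^n_+$, $\bar{x}\leqslant\bar{y}$ means $x_i\leqslant y_i$ for every $i\in\{1,\dots,n\}$. For $A\subseteq\mathbb{R}^n_+$, a function $f:A\to\mathbb{R}_+$ is isotone if $\bar{x}\leqslant\bar{y}$ implies $f(\bar{x})\leqslant f(\bar{y})$ for all $\bar{x},\bar{y}\in A$. An isotone function $f:A\to\mathbb{R}_+$ is subadditive if for every integer $m\geqslant 2$ and all $\bar{x},\bar{x}^1,\dots,\bar{x}^m\in A$, the inequality $\bar{x}\leqslant\sum_{i=1}^m\bar{x}^i$ implies $f(\bar{x})\leqslant\sum_{i=1}^m f(\bar{x}^i)$. (For isotone functions on $A=\mathbb{R}^n_+$ this is equivalent to the usual condition $f(\bar{x}+\bar{y})\leqslant f(\bar{x})+f(\bar{y})$ for all $\bar{x},\bar{y}$.) *)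

theory Defs
  imports "HOL-Analysis.Analysis"
begin

(* The order on real ^ 'n is the componentwise one (less_eq_vec_def), so {0..} is the
   nonnegative orthant; isotone functions on A are the library's mono_on A.
   Subadditivity is only ever used together with isotonicity, which is stated separately.
   The sum of the points xs i need not lie in A. *)

definition subadditive_on :: "(real ^ 'n) set \<Rightarrow> (real ^ 'n \<Rightarrow> real) \<Rightarrow> bool" where
  "subadditive_on A f \<longleftrightarrow>
     (\<forall>m\<ge>2. \<forall>x\<in>A. \<forall>xs :: nat \<Rightarrow> real ^ 'n.
        (\<forall>i\<in>{1..m}. xs i \<in> A) \<longrightarrow> x \<le> (\<Sum>i=1..m. xs i) \<longrightarrow> f x \<le> (\<Sum>i=1..m. f (xs i)))"

end

theory Submission
  imports Defs
begin

text \<open>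
  The extension is \<open>\<Psi> x = inf \<Sum> \<Phi> (x\<^sub>i)\<close>, the infimum being over all finite nonempty families in
  \<open>A\<close> whose sum dominates \<open>x\<close> in every coordinate that is positive somewhere on \<open>A\<close>. Ignoring the
  other coordinates makes every \<open>x\<close> admit such a family, and loses nothing on \<open>A\<close>, whose points
  vanish in these coordinates.
\<close>

definition covers :: "(real ^ 'n) set \<Rightarrow> real ^ 'n \<Rightarrow> (real ^ 'n) list set" where
  "covers A x =
     {xs. xs \<noteq> [] \<and> set xs \<subseteq> A \<and> (\<forall>i. (\<exists>a\<in>A. 0 < a $ i) \<longrightarrow> x $ i \<le> sum_list xs $ i)}"

definition cover_inf :: "(real ^ 'n) set \<Rightarrow> (real ^ 'n \<Rightarrow> real) \<Rightarrow> real ^ 'n \<Rightarrow> real" where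
  "cover_inf A f x = (INF xs\<in>covers A x. sum_list (map f xs))"

lemma sum_list_replicate_vec_nth: "sum_list (replicate k a) $ i = of_nat k * (a $ i :: real)"
  by (induction k) (simp_all add: algebra_simps)

text \<open>The coordinates positive somewhere on \<open>A\<close> are treated one at a time. For a
  new one, enough copies of a point positive there are appended; this is where lists, which allow
  repetition, matter. Points of \<open>A\<close> being nonnegative, the bounds already reached
  persist.\<close>

lemma covers_nonempty:
  fixes A :: "(real ^ 'n) set"
  assumes "A \<noteq> {}" and A: "A \<subseteq> {0..}"
  shows "covers A x \<noteq> {}"
proof -
  have "\<exists>xs. xs \<noteq> [] \<and> set xs \<subseteq> A \<and> (\<forall>i\<in>T. x $ i \<le> sum_list xs $ i)"
    if "finite T" and "T \<subseteq> {i. \<exists>a\<in>A. 0 < a $ i}" for T :: "'n set"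
    using that
  proof (induction T rule: finite_induct)
    case empty
    obtain a where "a \<in> A" using assms(1) by blast
    then show ?case by (intro exI[of _ "[a]"]) simp
  next
    case (insert j T)
    then obtain xs where xs: "xs \<noteq> []" "set xs \<subseteq> A" "\<forall>i\<in>T. x $ i \<le> sum_list xs $ i"
      by auto
    obtain a where a: "a \<in> A" "0 < a $ j" using insert.prems by auto
    obtain k where k: "x $ j - sum_list xs $ j < of_nat k * a $ j"
      using reals_Archimedean3[OF a(2)] by blast
    have "0 \<le> a $ i" for i using A a(1) by (auto simp: less_eq_vec_def)
    then have "x $ i \<le> sum_list (xs @ replicate k a) $ i" if "i \<in> insert j T" for i
      using that k xs(3) by (auto simp: sum_list_replicate_vec_nth intro: add_increasing2)
    then show ?case using xs a by (intro exI[of _ "xs @ replicate k a"]) auto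
  qed
  \<comment> \<open>The index type is finite, so all constrained coordinates can be taken at
    once.\<close>
  from this[of "{i. \<exists>a\<in>A. 0 < a $ i}"] show ?thesis by (auto simp: covers_def)
qed

lemma covers_antimono: "x \<le> y \<Longrightarrow> covers A y \<subseteq> covers A x"
  unfolding covers_def less_eq_vec_def by (blast intro: order_trans)

lemma append_mem_covers:
  "xs \<in> covers A x \<Longrightarrow> ys \<in> covers A y \<Longrightarrow> xs @ ys \<in> covers A (x + y)"
  unfolding covers_def
  by (simp only: mem_Collect_eq set_append sum_list_append vector_add_component)
    (blast intro: add_mono)

text \<open>If \<open>a $ i\<close> is positive, \<open>a\<close> itself witnesses that coordinate
  \<open>i\<close> is constrained; otherwise \<open>a $ i\<close> is at most 0, hence at most the
  nonnegative sum.\<close>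

lemma le_sum_list_cover:
  assumes "A \<subseteq> {0..}" "a \<in> A" "xs \<in> covers A a"
  shows "a \<le> sum_list xs"
  unfolding less_eq_vec_def
proof
  fix i
  have "0 \<le> sum_list xs"
    using assms by (intro sum_list_nonneg) (auto simp: covers_def)
  then show "a $ i \<le> sum_list xs $ i"
    using assms(2,3) unfolding covers_def less_eq_vec_def
    by (cases "0 < a $ i") (blast, force intro: order_trans[of _ 0])
qed

lemma cover_cost_nonneg:
  fixes f :: "real ^ 'n \<Rightarrow> real"
  assumes "f \<in> A \<rightarrow> {0..}" "xs \<in> covers A x"
  shows "0 \<le> sum_list (map f xs)"
  using assms by (intro sum_list_nonneg) (auto simp: covers_def)

lemma cover_inf_le:
  assumes "f \<in> A \<rightarrow> {0..}" "xs \<in> covers A x"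
  shows "cover_inf A f x \<le> sum_list (map f xs)"
  unfolding cover_inf_def
  using assms by (intro cINF_lower bdd_belowI2[where m = 0]) (auto intro: cover_cost_nonneg)

context
  fixes A :: "(real ^ 'n) set" and f :: "real ^ 'n \<Rightarrow> real"
  assumes A: "A \<noteq> {}" "A \<subseteq> {0..}" and f: "f \<in> A \<rightarrow> {0..}"
begin

lemma cover_inf_greatest:
  "(\<And>xs. xs \<in> covers A x \<Longrightarrow> c \<le> sum_list (map f xs)) \<Longrightarrow> c \<le> cover_inf A f x"
  unfolding cover_inf_def by (rule cINF_greatest[OF covers_nonempty[OF A]])

lemma cover_inf_nonneg: "0 \<le> cover_inf A f x"
  by (rule cover_inf_greatest) (rule cover_cost_nonneg[OF f])

lemma cover_inf_mono: "x \<le> y \<Longrightarrow> cover_inf A f x \<le> cover_inf A f y"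
  using covers_antimono by (blast intro: cover_inf_greatest cover_inf_le[OF f])

text \<open>Concatenating a cover of \<open>x\<close> with one of \<open>y\<close> covers
  \<open>x + y\<close>, and the costs add up. The infimum is taken first over covers of
  \<open>x\<close> with \<open>ys\<close> fixed, then over \<open>ys\<close>.\<close>

lemma cover_inf_add: "cover_inf A f (x + y) \<le> cover_inf A f x + cover_inf A f y"
proof -
  have "cover_inf A f (x + y) - sum_list (map f ys) \<le> cover_inf A f x" if "ys \<in> covers A y" for ys
    using cover_inf_le[OF f append_mem_covers[OF _ that]]
    by (intro cover_inf_greatest) (simp add: algebra_simps)
  then have "cover_inf A f (x + y) - cover_inf A f x \<le> cover_inf A f y"
    by (intro cover_inf_greatest) (simp add: algebra_simps)
  then show ?thesis by simp
qed

text \<open>The case \<open>m = 0\<close> is excluded because covers are nonempty lists: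
  \<open>cover_inf A f 0\<close> is positive when, for instance, \<open>f\<close> is constantly 1 on
  \<open>A\<close>.\<close>

lemma cover_inf_sum:
  fixes xs :: "nat \<Rightarrow> real ^ 'n"
  shows "1 \<le> m \<Longrightarrow> cover_inf A f (\<Sum>i=1..m. xs i) \<le> (\<Sum>i=1..m. cover_inf A f (xs i))"
proof (induction m rule: dec_induct)
  case (step k)
  then show ?case using cover_inf_add[of "\<Sum>i=1..k. xs i" "xs (Suc k)"] by simp
qed simp

text \<open>Monotonicity and the sum bound hold on the whole space, so \<open>B\<close> can be
  arbitrary.\<close>

lemma subadditive_on_cover_inf: "subadditive_on B (cover_inf A f)"
  unfolding subadditive_on_def
  using cover_inf_mono cover_inf_sum by (meson order_trans one_le_numeral)

text \<open>The one-point cover \<open>[a]\<close> gives the upper bound. For the lower bound, every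
  cover of \<open>a\<close> dominates \<open>a\<close> in all coordinates, so the assumptions on
  \<open>f\<close> apply to it.\<close>

lemma cover_inf_eq:
  assumes mono: "mono_on A f" and sub: "subadditive_on A f" and a: "a \<in> A"
  shows "cover_inf A f a = f a"
proof (rule antisym)
  have "[a] \<in> covers A a" using a by (simp add: covers_def)
  from cover_inf_le[OF f this] show "cover_inf A f a \<le> f a" by simp
next
  show "f a \<le> cover_inf A f a"
  proof (rule cover_inf_greatest)
    fix xs assume xs: "xs \<in> covers A a"
    then have ne: "xs \<noteq> []" and sub_A: "set xs \<subseteq> A" by (auto simp: covers_def)
    have le: "a \<le> sum_list xs" by (rule le_sum_list_cover[OF A(2) a xs])
    \<comment> \<open>List positions start at 0, the families in \<open>subadditive_on\<close> at 1.
      The type is left general because both the points and their values are summed.\<close>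
    have shift: "(\<Sum>i=1..length ys. ys ! (i - 1)) = sum_list ys"
      for ys :: "'b::comm_monoid_add list"
      unfolding sum_list_sum_nth by (rule sum.reindex_bij_witness[of _ Suc "\<lambda>i. i - 1"]) auto
    show "f a \<le> sum_list (map f xs)"
    \<comment> \<open>Subadditivity speaks only of \<open>m \<ge> 2\<close>; a one-point cover is
      settled by monotonicity.\<close>
    proof (cases "length xs = 1")
      case True
      then obtain b where "xs = [b]" by (auto simp: length_Suc_conv)
      then show ?thesis using mono a sub_A le by (auto dest: mono_onD)
    next
      case False
      then have "2 \<le> length xs" using ne by (cases xs) (auto simp: Suc_le_eq)
      moreover have "\<forall>i\<in>{1..length xs}. xs ! (i - 1) \<in> A"
        using sub_A by (auto intro!: subsetD[OF sub_A] nth_mem)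
      ultimately have "f a \<le> (\<Sum>i=1..length xs. f (xs ! (i - 1)))"
        using sub[unfolded subadditive_on_def, rule_format, of "length xs" a "\<lambda>i. xs ! (i - 1)"]
          a le shift[of xs] by simp
      also have "\<dots> = (\<Sum>i=1..length (map f xs). map f xs ! (i - 1))"
        by (rule sum.cong) auto
      finally show ?thesis unfolding shift .
    qed
  qed
qed

end

lemma subadditive_on_subset: "subadditive_on B f \<Longrightarrow> A \<subseteq> B \<Longrightarrow> subadditive_on A f"
  unfolding subadditive_on_def by (meson subsetD)

lemma subadditive_on_cong:
  "subadditive_on A g" if "subadditive_on A f" "\<forall>x\<in>A. f x = g x"
  unfolding subadditive_on_def
proof (intro allI ballI impI)
  fix m x and xs :: "nat \<Rightarrow> real ^ 'a"
  assume *: "2 \<le> m" "x \<in> A" "\<forall>i\<in>{1..m}. xs i \<in> A" "x \<le> (\<Sum>i=1..m. xs i)"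
  then have "f x \<le> (\<Sum>i=1..m. f (xs i))" using that(1) unfolding subadditive_on_def by blast
  also have "\<dots> = (\<Sum>i=1..m. g (xs i))" using * that(2) by (intro sum.cong) auto
  finally show "g x \<le> (\<Sum>i=1..m. g (xs i))" using * that(2) by simp
qed

theorem lemma2p11:
  fixes A :: "(real ^ 'n) set" and \<Phi> :: "real ^ 'n \<Rightarrow> real"
  assumes "A \<noteq> {}" and "A \<subseteq> {0..}" and "\<Phi> \<in> A \<rightarrow> {0..}"
  shows "(mono_on A \<Phi> \<and> subadditive_on A \<Phi>) \<longleftrightarrow>
    (\<exists>\<Psi> :: real ^ 'n \<Rightarrow> real. \<Psi> \<in> {0..} \<rightarrow> {0..} \<and> mono_on {0..} \<Psi> \<and> subadditive_on {0..} \<Psi> \<and>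
       (\<forall>x\<in>A. \<Psi> x = \<Phi> x))"
proof
  assume "mono_on A \<Phi> \<and> subadditive_on A \<Phi>"
  then show "\<exists>\<Psi> :: real ^ 'n \<Rightarrow> real. \<Psi> \<in> {0..} \<rightarrow> {0..} \<and> mono_on {0..} \<Psi> \<and>
      subadditive_on {0..} \<Psi> \<and> (\<forall>x\<in>A. \<Psi> x = \<Phi> x)"
    using cover_inf_nonneg[OF assms] cover_inf_mono[OF assms] subadditive_on_cover_inf[OF assms]
      cover_inf_eq[OF assms]
    by (intro exI[of _ "cover_inf A \<Phi>"]) (auto intro: mono_onI)
next
  assume "\<exists>\<Psi> :: real ^ 'n \<Rightarrow> real. \<Psi> \<in> {0..} \<rightarrow> {0..} \<and> mono_on {0..} \<Psi> \<and>
      subadditive_on {0..} \<Psi> \<and> (\<forall>x\<in>A. \<Psi> x = \<Phi> x)"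
  then obtain \<Psi> where \<Psi>: "mono_on {0..} \<Psi>" "subadditive_on {0..} \<Psi>" "\<forall>x\<in>A. \<Psi> x = \<Phi> x"
    by blast
  have "mono_on A \<Phi>"
    using mono_on_subset[OF \<Psi>(1) assms(2)] \<Psi>(3) by (simp add: monotone_on_def)
  moreover have "subadditive_on A \<Phi>"
    using subadditive_on_cong[OF subadditive_on_subset[OF \<Psi>(2) assms(2)] \<Psi>(3)] .
  ultimately show "mono_on A \<Phi> \<and> subadditive_on A \<Phi>" by blast
qed

end
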